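(* Let $G$ be an isolate-free graph with minimum degree $\delta(G)$ and maximum degree $\Delta(G)$. If $\delta(G)<\left\lfloor\frac{\Delta(G)+2}{2}\right\rfloor$, then $$TC(G)\le \delta(G)\,\bigl(\Delta(G)-\delta(G)+2\bigr).$$
   Context: All graphs are finite and simple (no loops or multiple edges). A graph is isolate-free if it has no vertex of degree $0$. A set $T\subseteq V$ of vertices of a graph $G(V,E)$ is a total dominating set if every vertex of $V$ is adjacent to at least one vertex of $T$. Two disjoint sets $A,B\subset V$ form a total coalition if neither $A$ nor $B$ is a total dominating set, but $A\cup B$ is. A total coalition partition of $G$ is a partition $\Psi=\{C_1,\dots,C_k\}$ of $V$ into non-empty classes such that for every $i$ there exists $j\neq i$ such that $C_i$ and $C_j$ form a total coalition. The total coalition number $TC(G)$ of an isolate-free graph $G$ is the maximum cardinality (number of classes) of a total coalition partition of $G$. *)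

theory Defs
  imports Complex_Main "Graph_Theory.Digraph" "HOL-Library.Disjoint_Sets"
begin

text \<open>
  Finite simple graphs are the locale \<^locale>\<open>graph\<close>: finite, loop-free, symmetric digraphs without
  parallel arcs. An undirected edge $uv$ is represented by the two arcs from $u$ to $v$ and from
  $v$ to $u$, so the degree of a vertex is its \<^const>\<open>out_degree\<close> (equivalently, its
  \<^const>\<open>in_degree\<close>), and the adjacency relation is \<^term>\<open>u \<rightarrow>\<^bsub>G\<^esub> v\<close>.
\<close>

definition min_degree :: "('a, 'b) pre_digraph \<Rightarrow> nat" where
  "min_degree G = Min (out_degree G ` verts G)"

definition max_degree :: "('a, 'b) pre_digraph \<Rightarrow> nat" where
  "max_degree G = Max (out_degree G ` verts G)"

definition isolate_free :: "('a, 'b) pre_digraph \<Rightarrow> bool" where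
  "isolate_free G \<longleftrightarrow> (\<forall>v \<in> verts G. out_degree G v \<noteq> 0)"

definition total_dominating_set :: "('a, 'b) pre_digraph \<Rightarrow> 'a set \<Rightarrow> bool" where
  "total_dominating_set G T \<longleftrightarrow>
     T \<subseteq> verts G \<and> (\<forall>v \<in> verts G. \<exists>u \<in> T. v \<rightarrow>\<^bsub>G\<^esub> u)"

definition total_coalition :: "('a, 'b) pre_digraph \<Rightarrow> 'a set \<Rightarrow> 'a set \<Rightarrow> bool" where
  "total_coalition G A B \<longleftrightarrow>
     A \<subseteq> verts G \<and> B \<subseteq> verts G \<and> A \<inter> B = {} \<and>
     \<not> total_dominating_set G A \<and> \<not> total_dominating_set G B \<and>
     total_dominating_set G (A \<union> B)"

definition total_coalition_partition :: "('a, 'b) pre_digraph \<Rightarrow> 'a set set \<Rightarrow> bool" where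
  "total_coalition_partition G P \<longleftrightarrow>
     partition_on (verts G) P \<and> (\<forall>C \<in> P. \<exists>D \<in> P. D \<noteq> C \<and> total_coalition G C D)"

text \<open>
  For finite \<^term>\<open>G\<close> the set below is finite. It is nonempty if \<^term>\<open>G\<close> is moreover isolate-free
  with at least one vertex; for other graphs the value carries no meaning.
\<close>

definition total_coalition_number :: "('a, 'b) pre_digraph \<Rightarrow> nat" where
  "total_coalition_number G = Max (card ` {P. total_coalition_partition G P})"

end

theory Submission
  imports Defs
begin

text \<open>
  Let \<open>x\<close> be a vertex of degree \<open>\<delta>\<close>, and let \<open>K\<close> be the set of the \<open>k \<le> \<delta>\<close> classes that meet the
  neighbourhood of \<open>x\<close>. Every coalition has a member in \<open>K\<close>. Choose for each class \<open>C\<close> a vertex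
  \<open>w C\<close> with no neighbour in \<open>C\<close>, and let \<open>J C\<close> be the set of the classes in \<open>K\<close> that do not meet the
  neighbourhood of \<open>w C\<close>. All partners of a member of \<open>J C\<close> meet this neighbourhood, so do the
  \<open>k - |J C|\<close> other members of \<open>K\<close>, and therefore at most \<open>\<Delta> - k + |J C|\<close> classes outside \<open>K\<close> are
  partners of members of \<open>J C\<close>. If \<open>C\<^sub>0 \<in> K\<close> maximises \<open>m = |J C|\<close>, then \<open>K\<close> is covered by the \<open>J C\<close>
  for \<open>C \<in> {C\<^sub>0} \<union> (K - J C\<^sub>0)\<close>, and there are at most
  \<open>(k - m + 1)(\<Delta> - k + m) \<le> k(\<Delta> - k + 1)\<close> classes outside \<open>K\<close>, because \<open>k \<le> \<Delta> - k\<close>. Finally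
  \<open>k(\<Delta> - k + 2)\<close> increases in \<open>k\<close> up to \<open>\<delta>\<close>.
\<close>

lemma total_dominating_set_mono:
  assumes "total_dominating_set G S" "S \<subseteq> T" "T \<subseteq> verts G"
  shows "total_dominating_set G T"
  using assms unfolding total_dominating_set_def by blast

lemma total_coalition_commute: "total_coalition G A B \<longleftrightarrow> total_coalition G B A"
  unfolding total_coalition_def by (auto simp: Un_commute Int_commute)

lemma (in loopfree_digraph) not_adj_self: "\<not> v \<rightarrow>\<^bsub>G\<^esub> v"
  using no_loops by (auto simp: arcs_ends_def arc_to_ends_def)

text \<open>Each such class is charged to an arc from \<open>v\<close> with head in it; by
  disjointness no arc is charged twice.\<close>

lemma (in fin_digraph) card_classes_meeting_neighbourhood:
  assumes "disjoint P"
  shows "card {C \<in> P. \<exists>u \<in> C. v \<rightarrow>\<^bsub>G\<^esub> u} \<le> out_degree G v"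
  unfolding out_degree_def
proof (rule card_le_if_inj_on_rel[where r = "\<lambda>C e. head G e \<in> C"])
  show "finite (out_arcs G v)"
    by (rule finite_subset[OF _ finite_arcs]) (auto simp: out_arcs_def)
  show "\<exists>e. e \<in> out_arcs G v \<and> head G e \<in> C"
    if "C \<in> {C \<in> P. \<exists>u \<in> C. v \<rightarrow>\<^bsub>G\<^esub> u}" for C
    using that by (auto simp: arcs_ends_def arc_to_ends_def out_arcs_def)
  show "C = D" if "C \<in> {C \<in> P. \<exists>u \<in> C. v \<rightarrow>\<^bsub>G\<^esub> u}" "D \<in> {C \<in> P. \<exists>u \<in> C. v \<rightarrow>\<^bsub>G\<^esub> u}"
    "head G e \<in> C" "head G e \<in> D" for C D e
    using that disjointD[OF assms, of C D] by blast
qed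

text \<open>Any vertex \<open>a\<close> of \<open>S\<close> can be split off: it has a neighbour in
  \<open>S\<close>, distinct from \<open>a\<close>, so both parts are nonempty proper
  subsets.\<close>

lemma (in loopfree_digraph) minimal_total_dominating_set_split:
  assumes "verts G \<noteq> {}" "total_dominating_set G S"
    and "\<And>T. T \<subset> S \<Longrightarrow> \<not> total_dominating_set G T"
  obtains A B where "A \<noteq> {}" "B \<noteq> {}" "A \<union> B = S" "total_coalition G A B"
proof -
  have sub: "S \<subseteq> verts G" and dom: "\<And>v. v \<in> verts G \<Longrightarrow> \<exists>u \<in> S. v \<rightarrow>\<^bsub>G\<^esub> u"
    using assms(2) unfolding total_dominating_set_def by auto
  obtain a where a: "a \<in> S" using assms(1) dom by blast
  obtain b where b: "b \<in> S" "a \<rightarrow>\<^bsub>G\<^esub> b" using dom a sub by blast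
  have "a \<noteq> b" using b(2) not_adj_self by blast
  then have proper: "{a} \<subset> S" "S - {a} \<subset> S" and ne: "S - {a} \<noteq> {}" and un: "{a} \<union> (S - {a}) = S"
    using a b by auto
  have "total_coalition G {a} (S - {a})"
    unfolding total_coalition_def using assms(2) assms(3)[OF proper(1)] assms(3)[OF proper(2)] sub a un
    by auto
  with ne un that show thesis by blast
qed

text \<open>For \<open>W = verts G\<close> this makes the maximum in
  \<open>total_coalition_number\<close> one over a nonempty set. The general \<open>W\<close> allows
  recursion on what remains after removing a minimal total dominating subset.\<close>

lemma (in fin_digraph) partition_into_total_coalitions:
  assumes "loopfree_digraph G" "verts G \<noteq> {}" "total_dominating_set G W"
  shows "\<exists>P. partition_on W P \<and> (\<forall>C \<in> P. \<exists>D \<in> P. D \<noteq> C \<and> total_coalition G C D)"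
  using assms(3)
proof (induction "card W" arbitrary: W rule: less_induct)
  case less
  have W: "W \<subseteq> verts G" using less.prems unfolding total_dominating_set_def by blast
  then have fW: "finite W" using finite_verts finite_subset by blast
  have "finite {S. S \<subseteq> W \<and> total_dominating_set G S}" using fW by simp
  from finite_has_minimal[OF this] less.prems obtain S where S: "S \<subseteq> W" "total_dominating_set G S"
    and min: "\<And>T. T \<subseteq> W \<Longrightarrow> total_dominating_set G T \<Longrightarrow> T \<subseteq> S \<Longrightarrow> T = S"
    by (metis (mono_tags, lifting) empty_iff mem_Collect_eq subset_refl)
  have "\<not> total_dominating_set G T" if "T \<subset> S" for T
    using min[of T] that S(1) by blast
  with loopfree_digraph.minimal_total_dominating_set_split[OF assms(1,2) S(2)]
  obtain A B where ne: "A \<noteq> {}" "B \<noteq> {}" and AB: "A \<union> B = S" and co: "total_coalition G A B"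
    by metis
  have co': "total_coalition G B A" using co total_coalition_commute by metis
  have dis: "A \<inter> B = {}" and notA: "\<not> total_dominating_set G A" and notB: "\<not> total_dominating_set G B"
    using co unfolding total_coalition_def by auto
  define R where "R = W - S"
  have R: "R \<inter> A = {}" "R \<inter> B = {}" "A \<union> B \<union> R = W" unfolding R_def using AB S(1) by auto
  \<comment> \<open>The remainder \<open>R\<close> is partitioned recursively, or becomes a class
    with partner \<open>B\<close>, or is absorbed into \<open>B\<close>.\<close>
  consider "total_dominating_set G R"
    | "\<not> total_dominating_set G R" "total_dominating_set G (B \<union> R)"
    | "\<not> total_dominating_set G (B \<union> R)" by blast
  then show ?case
  proof cases
    case 1
    have "card R < card W"
      using fW R ne by (intro psubset_card_mono) auto
    from less.hyps[OF this 1] obtain P where P: "partition_on R P"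
      "\<And>C. C \<in> P \<Longrightarrow> \<exists>D \<in> P. D \<noteq> C \<and> total_coalition G C D" by blast
    have "partition_on W (insert A (insert B P))"
      using P(1) R ne dis unfolding partition_on_def disjoint_def by auto
    moreover have "\<forall>C \<in> insert A (insert B P). \<exists>D \<in> insert A (insert B P). D \<noteq> C \<and> total_coalition G C D"
      using P(2) co co' ne dis by (metis Int_absorb insert_iff)
    ultimately show ?thesis by blast
  next
    case 2
    have "R \<noteq> {}" using 2 notB by auto
    then have "partition_on W {A, B, R}"
      using R ne dis unfolding partition_on_def disjoint_def by auto
    moreover have "total_coalition G R B"
      using 2 notB R W unfolding total_coalition_def by (auto simp: Un_commute)
    ultimately show ?thesis
      using co co' ne dis R(2) by (intro exI[of _ "{A, B, R}"]) auto
  next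
    case 3
    have part: "partition_on W {A, B \<union> R}"
      using R ne dis unfolding partition_on_def disjoint_def by auto
    have "A \<union> (B \<union> R) = W" using R by blast
    then have "total_coalition G A (B \<union> R)"
      using 3 notA R W dis less.prems unfolding total_coalition_def by auto
    then show ?thesis
      using total_coalition_commute[of G A "B \<union> R"] part ne dis R(1)
      by (intro exI[of _ "{A, B \<union> R}"]) auto
  qed
qed

lemma (in fin_digraph) card_total_coalition_partition_le:
  assumes P: "total_coalition_partition G P" and x: "x \<in> verts G"
    and max: "\<And>v. v \<in> verts G \<Longrightarrow> out_degree G v \<le> n"
    and deg: "2 * out_degree G x \<le> n"
  shows "int (card P) \<le> int (out_degree G x) * (int n - int (out_degree G x) + 2)"
proof -
  have part: "partition_on (verts G) P"
    and ex: "\<And>C. C \<in> P \<Longrightarrow> \<exists>D \<in> P. total_coalition G C D"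
    using P unfolding total_coalition_partition_def by auto
  have disj: "disjoint P" and finP: "finite P" and sub: "\<And>C. C \<in> P \<Longrightarrow> C \<subseteq> verts G"
    using part finite_elements[OF finite_verts part] unfolding partition_on_def by auto
  define M where "M v = {C \<in> P. \<exists>u \<in> C. v \<rightarrow>\<^bsub>G\<^esub> u}" for v
  have cardM: "card (M v) \<le> out_degree G v" for v
    unfolding M_def by (rule card_classes_meeting_neighbourhood[OF disj])
  have finM: "finite (M v)" and MP: "M v \<subseteq> P" for v using finP unfolding M_def by auto
  have pair: "C \<in> M v \<or> D \<in> M v"
    if "C \<in> P" "D \<in> P" "total_coalition G C D" "v \<in> verts G" for C D v
    using that unfolding M_def total_coalition_def total_dominating_set_def by blast
  have "\<exists>v \<in> verts G. C \<notin> M v" if "C \<in> P" for C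
    using ex[OF that] sub[OF that] unfolding M_def total_coalition_def total_dominating_set_def
    by blast
  then obtain w where w: "\<And>C. C \<in> P \<Longrightarrow> w C \<in> verts G \<and> C \<notin> M (w C)" by metis
  define K where "K = M x"
  define J where "J C = K - M (w C)" for C
  define Q where "Q C = M (w C) - K" for C
  have KP: "K \<subseteq> P" and finK: "finite K" unfolding K_def using MP finM by auto
  have Jself: "C \<in> J C" if "C \<in> K" for C using that w KP unfolding J_def by auto
  have finJ: "finite (J C)" for C unfolding J_def using finK by simp
  have JK: "J C \<subseteq> K" for C unfolding J_def by auto
  \<comment> \<open>\<open>M (w C)\<close> consists of \<open>Q C\<close> and the members of
    \<open>K\<close> outside \<open>J C\<close>.\<close>
  have cardQ: "card (Q C) + card K \<le> n + card (J C)" if "C \<in> P" for C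
  proof -
    have "card (M (w C)) = card (Q C) + card (M (w C) \<inter> K)"
      unfolding Q_def using card_Int_Diff[OF finM, of "w C" K] by linarith
    moreover have "card K = card (J C) + card (M (w C) \<inter> K)"
      unfolding J_def using card_Int_Diff[OF finK, of "M (w C)"] by (simp add: Int_commute)
    moreover have "card (M (w C)) \<le> n" using cardM max w that le_trans by blast
    ultimately show ?thesis by linarith
  qed
  \<comment> \<open>A single partner \<open>D\<close> of \<open>E\<close> serves every
    \<open>C\<close>: \<open>pair\<close> at \<open>x\<close> forces \<open>D\<close> into
    \<open>K\<close>, and \<open>pair\<close> at \<open>w C\<close> forces \<open>E\<close> into
    \<open>M (w C)\<close> when \<open>D\<close> misses it.\<close>
  have partner: "\<exists>D \<in> K. \<forall>C \<in> P. D \<in> J C \<longrightarrow> E \<in> Q C" if E: "E \<in> P - K" for E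
  proof -
    obtain D where D: "D \<in> P" "total_coalition G E D" using ex E by blast
    have "D \<in> K" using pair[of E D x] D E x unfolding K_def by auto
    moreover have "E \<in> Q C" if "C \<in> P" "D \<in> J C" for C
      using pair[of E D "w C"] D E that w unfolding Q_def J_def by auto
    ultimately show ?thesis by blast
  qed
  have k: "card K \<le> out_degree G x" unfolding K_def by (rule cardM)
  have cardP: "card P = card K + card (P - K)"
    using card_mono[OF finP KP] by (simp add: card_Diff_subset[OF finK KP])
  have outside: "int (card (P - K)) \<le> int (card K) * (int n - int (card K) + 1)"
  proof (cases "K = {}")
    case True
    then have "P - K = {}" using partner by blast
    then show ?thesis using True by (metis card.empty mult_zero_left of_nat_0 order_refl)
  next
    case False
    have "Max ((\<lambda>C. card (J C)) ` K) \<in> (\<lambda>C. card (J C)) ` K"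
      using finK False by (intro Max_in) auto
    then obtain C\<^sub>0 where C0: "C\<^sub>0 \<in> K" "Max ((\<lambda>C. card (J C)) ` K) = card (J C\<^sub>0)" by auto
    define m where "m = card (J C\<^sub>0)"
    have m: "card (J C) \<le> m" if "C \<in> K" for C
      using that finK unfolding m_def C0(2)[symmetric] by (intro Max_ge) auto
    have m1: "1 \<le> m" unfolding m_def using Jself[OF C0(1)] finJ[of C\<^sub>0]
      by (metis One_nat_def Suc_leI card_gt_0_iff empty_iff)
    have mk: "m \<le> card K" unfolding m_def by (rule card_mono[OF finK JK])
    \<comment> \<open>A partner in \<open>J C\<^sub>0\<close> is handled by the index
      \<open>C\<^sub>0\<close>, any other \<open>D\<close> by itself, as \<open>D\<close> lies in
      \<open>J D\<close>.\<close>
    define I where "I = insert C\<^sub>0 (K - J C\<^sub>0)"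
    have finI: "finite I" and IK: "I \<subseteq> K" unfolding I_def using finK C0 by auto
    have cardI: "card I \<le> card K - m + 1"
      unfolding I_def m_def using card_insert_le_m1[of "card K - card (J C\<^sub>0) + 1" "K - J C\<^sub>0" C\<^sub>0]
      by (simp add: card_Diff_subset[OF finJ JK])
    have "P - K \<subseteq> (\<Union>C \<in> I. Q C)"
    proof
      fix E assume "E \<in> P - K"
      then obtain D where D: "D \<in> K" "\<And>C. C \<in> P \<Longrightarrow> D \<in> J C \<Longrightarrow> E \<in> Q C" using partner by blast
      show "E \<in> (\<Union>C \<in> I. Q C)"
      proof (cases "D \<in> J C\<^sub>0")
        case True
        then show ?thesis using D(2)[of C\<^sub>0] C0 KP unfolding I_def by auto
      next
        case False
        then show ?thesis using D Jself[of D] KP unfolding I_def by auto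
      qed
    qed
    then have "card (P - K) \<le> card (\<Union>C \<in> I. Q C)"
      using finI finM unfolding Q_def by (intro card_mono) auto
    also have "\<dots> \<le> (\<Sum>C \<in> I. card (Q C))" by (rule card_UN_le[OF finI])
    also have "\<dots> \<le> (\<Sum>C \<in> I. n - card K + m)"
    proof (rule sum_mono)
      fix C assume "C \<in> I"
      then have "C \<in> K" using IK by blast
      then show "card (Q C) \<le> n - card K + m" using cardQ[of C] m[of C] KP k deg by auto
    qed
    also have "\<dots> = card I * (n - card K + m)" by simp
    also have "\<dots> \<le> (card K - m + 1) * (n - card K + m)" using cardI by (rule mult_right_mono) simp
    finally have "int (card (P - K)) \<le> int ((card K - m + 1) * (n - card K + m))"
      using of_nat_le_iff by blast
    also have "\<dots> = (int (card K) - int m + 1) * (int n - int (card K) + int m)"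
      proof -
      have "int (card K - m) = int (card K) - int m" "int (n - card K) = int n - int (card K)"
        using mk k deg by auto
      then show ?thesis by (simp only: of_nat_mult of_nat_add of_nat_1)
    qed
    \<comment> \<open>The subtracted product is nonnegative, since \<open>m\<close> is at least 1
      and \<open>2 * card K\<close> at most \<open>n\<close>.\<close>
    also have "\<dots> = int (card K) * (int n - int (card K) + 1)
        - (int m - 1) * (int n - 2 * int (card K) + int m)"
      by (simp add: algebra_simps)
    also have "\<dots> \<le> int (card K) * (int n - int (card K) + 1)"
      using m1 k deg by simp
    finally show ?thesis .
  qed
  \<comment> \<open>This product is the increase of \<open>t * (n - t + 2)\<close> from
    \<open>t = card K\<close> to \<open>t = out_degree G x\<close>.\<close>
  have "0 \<le> (int (out_degree G x) - int (card K)) * (int n - int (out_degree G x) - int (card K) + 2)"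
    using k deg by (intro mult_nonneg_nonneg) linarith+
  then show ?thesis using outside cardP by (simp add: algebra_simps)
qed

theorem theorem4p2:
  fixes G :: "('a, 'b) pre_digraph"
  assumes "graph G"
    and "verts G \<noteq> {}"
    and "isolate_free G"
    and "int (min_degree G) < \<lfloor>(real (max_degree G) + 2) / 2\<rfloor>"
  shows "int (total_coalition_number G) \<le>
    int (min_degree G) * (int (max_degree G) - int (min_degree G) + 2)"
proof -
  interpret graph G by fact
  have "min_degree G \<in> out_degree G ` verts G"
    unfolding min_degree_def using assms(2) by (intro Min_in) auto
  then obtain x where x: "x \<in> verts G" "out_degree G x = min_degree G" by auto
  have max: "out_degree G v \<le> max_degree G" if "v \<in> verts G" for v
    unfolding max_degree_def using that by (intro Max_ge) auto
  have deg: "2 * out_degree G x \<le> max_degree G"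
  proof -
    \<comment> \<open>An integer strictly below a floor stays below the real number after adding 1,
      which cancels the 2 in the numerator.\<close>
    have "real (min_degree G) + 1 \<le> (real (max_degree G) + 2) / 2"
      using assms(4) by (simp add: less_floor_iff)
    then show ?thesis using x(2) by simp
  qed
  have "\<exists>u \<in> verts G. v \<rightarrow>\<^bsub>G\<^esub> u" if "v \<in> verts G" for v
  proof -
    have "out_arcs G v \<noteq> {}"
      using assms(3) that unfolding isolate_free_def out_degree_def by auto
    then obtain e where e: "e \<in> arcs G" "tail G e = v" by (auto simp: out_arcs_def)
    then have "v \<rightarrow>\<^bsub>G\<^esub> head G e" by (force simp: arcs_ends_def arc_to_ends_def)
    then show ?thesis using head_in_verts[OF e(1)] by blast
  qed
  then have "total_dominating_set G (verts G)" unfolding total_dominating_set_def by blast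
  from partition_into_total_coalitions[OF loopfree_digraph_axioms assms(2) this]
  have ne: "{P. total_coalition_partition G P} \<noteq> {}" unfolding total_coalition_partition_def by blast
  have "finite {P. total_coalition_partition G P}"
    by (rule finite_subset[OF _ finitely_many_partition_on[OF finite_verts]])
      (auto simp: total_coalition_partition_def)
  with ne have "total_coalition_number G \<in> card ` {P. total_coalition_partition G P}"
    unfolding total_coalition_number_def by (intro Max_in) auto
  then obtain P where "total_coalition_partition G P" "total_coalition_number G = card P" by auto
  then show ?thesis using card_total_coalition_partition_le[OF _ x(1) max deg] x(2) by simp
qed

end
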